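(* Let $n,r,t$ be positive integers with $nr$ even. Let $G=K_{n,\ldots,n,trn}$ be the complete $(r+1)$-partite graph with $r$ parts of size $n$ and one part of size $trn$. Then $\mathrm{def}(G)=0$.
   Context: A complete $(r+1)$-partite graph has its vertex set partitioned into $r+1$ nonempty independent sets with every two vertices in different parts adjacent. For a proper edge-coloring $\alpha$ of a graph $G$ (with positive integer colors) and a vertex $v$, let $S(v,\alpha)$ be the set of colors on edges incident to $v$, and $\mathrm{def}(v,\alpha)=\max S(v,\alpha)-\min S(v,\alpha)-|S(v,\alpha)|+1$. The deficiency of $G$ is $\mathrm{def}(G)=\min_\alpha \sum_{v\in V(G)}\mathrm{def}(v,\alpha)$ over all proper edge-colorings $\alpha$ of $G$; equivalently, the minimum number of pendant edges whose attachment to $G$ yields a graph admitting an interval coloring (a proper edge-coloring with colors $1,\ldots,t$, all used, in which every vertex's color set is an integer interval). In particular $\mathrm{def}(G)=0$ iff $G$ has an interval coloring. *)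

theory Defs
  imports Main "HOL-Library.Disjoint_Sets"
begin

text \<open>A finite simple graph is given by its vertex set \<open>V\<close> and its set \<open>E\<close> of edges, each edge
  being the two-element set of its endpoints.\<close>

definition finite_simple_graph :: "'a set \<Rightarrow> 'a set set \<Rightarrow> bool" where
  "finite_simple_graph V E \<longleftrightarrow> finite V \<and> (\<forall>e\<in>E. e \<subseteq> V \<and> card e = 2)"

definition independent_set :: "'a set set \<Rightarrow> 'a set \<Rightarrow> bool" where
  "independent_set E X \<longleftrightarrow> (\<forall>u\<in>X. \<forall>v\<in>X. {u, v} \<notin> E)"

text \<open>\<open>complete_multipartite [n\<^sub>1, \<dots>, n\<^sub>k] V E\<close> says that \<open>(V, E)\<close> is a complete \<open>k\<close>-partite graph
  with parts of sizes \<open>n\<^sub>1, \<dots>, n\<^sub>k\<close>.\<close>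

definition complete_multipartite :: "nat list \<Rightarrow> 'a set \<Rightarrow> 'a set set \<Rightarrow> bool" where
  "complete_multipartite ns V E \<longleftrightarrow>
     finite_simple_graph V E \<and>
     (\<exists>P. V = (\<Union>i<length ns. P i) \<and>
          disjoint_family_on P {..<length ns} \<and>
          (\<forall>i<length ns. P i \<noteq> {} \<and> card (P i) = ns ! i \<and> independent_set E (P i)) \<and>
          (\<forall>i<length ns. \<forall>j<length ns. i \<noteq> j \<longrightarrow> (\<forall>u\<in>P i. \<forall>v\<in>P j. {u, v} \<in> E)))"

definition proper_edge_coloring :: "'a set set \<Rightarrow> ('a set \<Rightarrow> nat) \<Rightarrow> bool" where
  "proper_edge_coloring E \<alpha> \<longleftrightarrow>
     (\<forall>e\<in>E. 1 \<le> \<alpha> e) \<and>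
     (\<forall>e\<in>E. \<forall>f\<in>E. e \<noteq> f \<and> e \<inter> f \<noteq> {} \<longrightarrow> \<alpha> e \<noteq> \<alpha> f)"

definition spectrum :: "'a set set \<Rightarrow> ('a set \<Rightarrow> nat) \<Rightarrow> 'a \<Rightarrow> nat set" where
  "spectrum E \<alpha> v = \<alpha> ` {e \<in> E. v \<in> e}"

text \<open>An isolated vertex has no colors, so \<open>Max\<close> and \<open>Min\<close> are meaningless there; it gets
  deficiency 0 by convention.\<close>

definition vertex_deficiency :: "'a set set \<Rightarrow> ('a set \<Rightarrow> nat) \<Rightarrow> 'a \<Rightarrow> int" where
  "vertex_deficiency E \<alpha> v =
     (if spectrum E \<alpha> v = {} then 0
      else int (Max (spectrum E \<alpha> v)) - int (Min (spectrum E \<alpha> v))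
           - int (card (spectrum E \<alpha> v)) + 1)"

text \<open>The minimum always exists for a finite simple graph, see \<open>deficiency_attained\<close> and
  \<open>deficiency_le\<close> below.\<close>

definition deficiency :: "'a set \<Rightarrow> 'a set set \<Rightarrow> int" where
  "deficiency V E =
     (LEAST d. \<exists>\<alpha>. proper_edge_coloring E \<alpha> \<and> d = (\<Sum>v\<in>V. vertex_deficiency E \<alpha> v))"

lemma finite_edges: "finite_simple_graph V E \<Longrightarrow> finite E"
  unfolding finite_simple_graph_def
  by (meson PowI finite_Pow_iff finite_subset subsetI)

lemma vertex_deficiency_nonneg:
  assumes "finite E"
  shows "0 \<le> vertex_deficiency E \<alpha> v"
proof (cases "spectrum E \<alpha> v = {}")
  case False
  let ?S = "spectrum E \<alpha> v"
  have fin: "finite ?S"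
    using assms by (simp add: spectrum_def)
  have "?S \<subseteq> {Min ?S..Max ?S}"
    using fin by auto
  then have "card ?S \<le> Suc (Max ?S) - Min ?S"
    using card_mono[of "{Min ?S..Max ?S}" ?S] by simp
  moreover have "Min ?S \<le> Max ?S"
    using fin False by simp
  ultimately show ?thesis
    using False by (simp add: vertex_deficiency_def)
qed (simp add: vertex_deficiency_def)

lemma proper_edge_coloring_exists:
  fixes E :: "'a set set"
  assumes "finite E"
  shows "\<exists>\<alpha>. proper_edge_coloring E \<alpha>"
proof -
  obtain f :: "'a set \<Rightarrow> nat" where f: "inj_on f E"
    using finite_imp_inj_to_nat_seg[OF assms] by blast
  have "proper_edge_coloring E (\<lambda>e. Suc (f e))"
    using f by (auto simp: proper_edge_coloring_def inj_on_def)
  then show ?thesis by blast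
qed

lemma deficiency_attained_le:
  assumes "finite_simple_graph V E"
  shows "(\<exists>\<alpha>. proper_edge_coloring E \<alpha> \<and> deficiency V E = (\<Sum>v\<in>V. vertex_deficiency E \<alpha> v)) \<and>
         (\<forall>\<alpha>. proper_edge_coloring E \<alpha> \<longrightarrow> deficiency V E \<le> (\<Sum>v\<in>V. vertex_deficiency E \<alpha> v))"
proof -
  let ?D = "\<lambda>\<alpha>. \<Sum>v\<in>V. vertex_deficiency E \<alpha> v"
  have fin: "finite E"
    using assms by (rule finite_edges)
  obtain \<alpha>0 where "proper_edge_coloring E \<alpha>0"
    using proper_edge_coloring_exists[OF fin] ..
  then obtain \<alpha> where \<alpha>: "proper_edge_coloring E \<alpha>"
    and min: "\<And>\<beta>. proper_edge_coloring E \<beta> \<Longrightarrow> nat (?D \<alpha>) \<le> nat (?D \<beta>)"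
    using ex_has_least_nat[of "proper_edge_coloring E" \<alpha>0 "\<lambda>\<alpha>. nat (?D \<alpha>)"] by blast
  have nonneg: "0 \<le> ?D \<beta>" for \<beta>
    by (intro sum_nonneg vertex_deficiency_nonneg fin)
  have le: "?D \<alpha> \<le> ?D \<beta>" if "proper_edge_coloring E \<beta>" for \<beta>
    using min[OF that] nonneg[of \<alpha>] nonneg[of \<beta>] by linarith
  have "deficiency V E = ?D \<alpha>"
    unfolding deficiency_def using \<alpha> le by (intro Least_equality) auto
  then show ?thesis
    using \<alpha> le by auto
qed

lemmas deficiency_attained = deficiency_attained_le[THEN conjunct1]
lemmas deficiency_le = deficiency_attained_le[THEN conjunct2, rule_format]

lemma complete_multipartite_exists:
  assumes "\<forall>i<length ns. 0 < ns ! i"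
  shows "\<exists>(V :: (nat \<times> nat) set) E. complete_multipartite ns V E"
proof -
  define P where "P i = {i} \<times> {..<ns ! i}" for i
  define V where "V = (\<Union>i<length ns. P i)"
  define E where "E = {{u, v} | u v. u \<in> V \<and> v \<in> V \<and> fst u \<noteq> fst v}"
  have "finite_simple_graph V E"
    by (auto simp: finite_simple_graph_def E_def V_def P_def card_2_iff)
  moreover have "V = (\<Union>i<length ns. P i)" "disjoint_family_on P {..<length ns}"
    by (auto simp: V_def P_def disjoint_family_on_def)
  moreover have "P i \<noteq> {} \<and> card (P i) = ns ! i \<and> independent_set E (P i)" if "i < length ns" for i
    using that assms
    by (fastforce simp: P_def card_cartesian_product independent_set_def E_def doubleton_eq_iff)
  moreover have "{u, v} \<in> E"
    if "i < length ns" "j < length ns" "i \<noteq> j" "u \<in> P i" "v \<in> P j" for i j u v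
    using that by (fastforce simp: E_def V_def P_def)
  ultimately have "complete_multipartite ns V E"
    unfolding complete_multipartite_def by blast
  then show ?thesis by blast
qed

end

theory Submission
  imports Defs "HOL-Number_Theory.Cong"
begin

text \<open>Write \<open>N = nr\<close>. Split the large part into \<open>t\<close> blocks of \<open>N\<close> vertices and color the
  \<open>k\<close>-th copy of \<open>K\<^sub>N\<^sub>,\<^sub>N\<close> by a Latin square on the colors \<open>kN + 1, \<dots>, kN + N\<close>. A vertex of the
  large part then sees one block of \<open>N\<close> colors and every other vertex sees \<open>1, \<dots>, tN\<close>, so it
  suffices to continue with a one-factorization of the balanced complete \<open>r\<close>-partite graph on the
  colors \<open>tN + 1, \<dots>, tN + (r - 1)n\<close>. If \<open>r\<close> is even, blow up a one-factorization of \<open>K\<^sub>r\<close> by \<open>n\<close>.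
  If \<open>n\<close> is even, remove one factor from a one-factorization of \<open>K\<^sub>2\<^sub>r\<close>, which leaves the balanced
  complete \<open>r\<close>-partite graph with parts of size 2, and blow up by \<open>n / 2\<close>.\<close>

section \<open>Modular cancellation and the circle method\<close>

lemma mod_add_left_cancel_nat:
  fixes x y z M :: nat
  assumes "(x + y) mod M = (x + z) mod M" "y < M" "z < M"
  shows "y = z"
proof -
  have "[y = z] (mod M)"
    using assms(1) by (metis cong_def cong_add_lcancel_nat)
  then show ?thesis
    using assms(2,3) by (simp add: cong_def)
qed

text \<open>The circle method: a one-factorization of the complete graph on \<open>{0..M}\<close> for odd \<open>M\<close>, in
  which \<open>M\<close> plays the role of the point at infinity.\<close>

definition circle_color :: "nat \<Rightarrow> nat \<Rightarrow> nat \<Rightarrow> nat" where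
  "circle_color M x y =
     (if x = M then (y + y) mod M else if y = M then (x + x) mod M else (x + y) mod M)"

lemma circle_color_commute: "circle_color M x y = circle_color M y x"
  by (simp add: circle_color_def add.commute)

lemma circle_color_less: "0 < M \<Longrightarrow> circle_color M x y < M"
  by (simp add: circle_color_def)

text \<open>For \<open>x = M\<close>, doubling is injective modulo the odd number \<open>M\<close>.
  For \<open>x < M\<close>, the neighbour \<open>M\<close> gets the residue \<open>x + x\<close>,
  which no \<open>x + y\<close> with \<open>y < M\<close> and \<open>y\<close> distinct from
  \<open>x\<close> attains.\<close>

lemma circle_color_inj:
  assumes "odd M" "x \<le> M" "y \<le> M" "z \<le> M" "x \<noteq> y" "x \<noteq> z"
    and eq: "circle_color M x y = circle_color M x z"
  shows "y = z"
proof (cases "x = M")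
  case True
  have "[2 * y = 2 * z] (mod M)"
    using eq True by (simp add: circle_color_def cong_def mult_2)
  moreover have "coprime 2 M"
    using \<open>odd M\<close> by simp
  ultimately have "[y = z] (mod M)"
    by (simp add: cong_mult_lcancel_nat)
  then show ?thesis
    using assms True by (simp add: cong_def)
next
  case False
  then have "x < M" using assms by simp
  consider "y = M" "z = M" | "y < M" "z = M" | "y = M" "z < M" | "y < M" "z < M"
    using assms by linarith
  then show ?thesis
  proof cases
    case 2
    then show ?thesis
      using eq False \<open>x < M\<close> \<open>x \<noteq> y\<close> mod_add_left_cancel_nat[of x y M x]
      by (simp add: circle_color_def)
  next
    case 3
    then show ?thesis
      using eq False \<open>x < M\<close> \<open>x \<noteq> z\<close> mod_add_left_cancel_nat[of x x M z]
      by (simp add: circle_color_def)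
  next
    case 4
    then show ?thesis
      using eq False mod_add_left_cancel_nat[of x y M z]
      by (simp add: circle_color_def)
  qed simp
qed

text \<open>The pairs \<open>{x, M - x}\<close>, among them \<open>{0, M}\<close>, all have color 0.
  By injectivity at \<open>x\<close> no other pair has it, so color 0 is exactly this perfect
  matching, the factor to be removed.\<close>

lemma circle_color_pos:
  assumes "odd M" "x \<le> M" "y \<le> M" "x \<noteq> y" "x + y \<noteq> M"
  shows "0 < circle_color M x y"
proof (rule ccontr)
  assume "\<not> 0 < circle_color M x y"
  moreover have "circle_color M x (M - x) = 0"
    using assms(2) by (auto simp: circle_color_def)
  moreover have "x \<noteq> M - x"
    using assms(1,2) by presburger
  ultimately show False
    using circle_color_inj[of M x y "M - x"] assms by simp
qed

section \<open>Blowing up a coloring\<close>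

text \<open>Every base vertex becomes \<open>m\<close> copies. A base edge of color \<open>k\<close>
  becomes a complete bipartite graph, colored by the cyclic Latin square of order \<open>m\<close>
  within the \<open>k\<close>-th block of \<open>m\<close> colors.\<close>

definition blow_up :: "nat \<Rightarrow> (nat \<Rightarrow> nat \<Rightarrow> nat) \<Rightarrow> nat \<times> nat \<Rightarrow> nat \<times> nat \<Rightarrow> nat" where
  "blow_up m d u v = d (fst u) (fst v) * m + (snd u + snd v) mod m"

lemma blow_up_less:
  assumes "d (fst u) (fst v) < D" "0 < m"
  shows "blow_up m d u v < D * m"
proof -
  have "blow_up m d u v < Suc (d (fst u) (fst v)) * m"
    using assms(2) by (simp add: blow_up_def)
  also have "\<dots> \<le> D * m"
    using assms(1) by (intro mult_le_mono1) simp
  finally show ?thesis .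
qed

lemma blow_up_commute:
  "d (fst u) (fst v) = d (fst v) (fst u) \<Longrightarrow> blow_up m d u v = blow_up m d v u"
  by (simp add: blow_up_def add.commute)

text \<open>The quotient of a color by \<open>m\<close> is the base color; the remainder determines
  the copy, since \<open>snd u\<close> cancels modulo \<open>m\<close>.\<close>

lemma blow_up_eqD:
  assumes "blow_up m d u v = blow_up m d u w" "snd v < m" "snd w < m"
  shows "d (fst u) (fst v) = d (fst u) (fst w)" and "snd v = snd w"
proof -
  have "0 < m" using assms(2) by simp
  have "blow_up m d u v div m = blow_up m d u w div m"
    "blow_up m d u v mod m = blow_up m d u w mod m"
    using assms(1) by simp_all
  then show "d (fst u) (fst v) = d (fst u) (fst w)"
    and "snd v = snd w"
    using \<open>0 < m\<close> assms(2,3) mod_add_left_cancel_nat[of "snd u" "snd v" m "snd w"]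
    by (simp_all add: blow_up_def)
qed

section \<open>One-factorization of the balanced complete multipartite graph\<close>

text \<open>Each vertex has \<open>(r - 1) * n\<close> neighbours, as many as there are colors, so
  injectivity at every vertex already makes each color class a perfect matching.\<close>

lemma balanced_multipartite_one_factorization:
  fixes n r :: nat
  assumes "0 < n" "0 < r" "even (n * r)"
  obtains c :: "nat \<times> nat \<Rightarrow> nat \<times> nat \<Rightarrow> nat" where
    "\<And>u v. c u v = c v u"
    "\<And>u v. \<lbrakk>u \<in> {..<r} \<times> {..<n}; v \<in> {..<r} \<times> {..<n}; fst u \<noteq> fst v\<rbrakk> \<Longrightarrow> c u v < (r - 1) * n"
    "\<And>u v w. \<lbrakk>u \<in> {..<r} \<times> {..<n}; v \<in> {..<r} \<times> {..<n}; w \<in> {..<r} \<times> {..<n};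
       fst u \<noteq> fst v; fst u \<noteq> fst w; c u v = c u w\<rbrakk> \<Longrightarrow> v = w"
proof (cases "even r")
  case True
  \<comment> \<open>The base graph has vertices \<open>0, ..., r - 1\<close>, with
    \<open>r - 1\<close> as the point at infinity.\<close>
  define c where "c = blow_up n (circle_color (r - 1))"
  have M: "odd (r - 1)" using True \<open>0 < r\<close> by simp
  then have M0: "0 < r - 1" by (rule odd_pos)
  show ?thesis
  proof (rule that)
    show "c u v = c v u" for u v
      unfolding c_def by (intro blow_up_commute circle_color_commute)
    show "c u v < (r - 1) * n" for u v
      unfolding c_def using \<open>0 < n\<close> M0 by (intro blow_up_less circle_color_less)
    fix u v w
    assume in_dom: "u \<in> {..<r} \<times> {..<n}" "v \<in> {..<r} \<times> {..<n}" "w \<in> {..<r} \<times> {..<n}"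
      and ne: "fst u \<noteq> fst v" "fst u \<noteq> fst w" and eq: "c u v = c u w"
    have "snd v < n" "snd w < n" using in_dom by auto
    note * = blow_up_eqD[OF eq[unfolded c_def] this]
    have "fst u \<le> r - 1" "fst v \<le> r - 1" "fst w \<le> r - 1" using in_dom by auto
    then have "fst v = fst w" using circle_color_inj[OF M] ne *(1) by blast
    then show "v = w" using *(2) by (rule prod_eqI)
  qed
next
  case False
  then have "even n" using assms by simp
  then obtain m where n: "n = 2 * m" by (elim evenE)
  have "0 < m" using \<open>0 < n\<close> n by simp
  \<comment> \<open>The base graph now has the \<open>2 * r\<close> vertices
    \<open>0, ..., M\<close>.\<close>
  define M where "M = 2 * r - 1"
  have M: "odd M" using \<open>0 < r\<close> by (simp add: M_def)
  \<comment> \<open>Part \<open>x\<close> is spread over the pair \<open>{x, M - x}\<close> of the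
    removed matching, its first \<open>m\<close> vertices over \<open>x\<close> and the other
    \<open>m\<close> over \<open>M - x\<close>.\<close>
  define b :: "nat \<times> nat \<Rightarrow> nat \<times> nat"
    where "b u = (if snd u < m then fst u else M - fst u, snd u mod m)" for u
  \<comment> \<open>With color 0 removed, the colors \<open>1, ..., M - 1\<close> shift down to
    \<open>0, ..., 2 * r - 3\<close>. The truncated subtraction loses nothing between different
    parts, where \<open>pos\<close> holds.\<close>
  define d where "d x y = circle_color M x y - 1" for x y
  define c where "c u v = blow_up m d (b u) (b v)" for u v
  have b_le: "fst (b u) \<le> M" if "u \<in> {..<r} \<times> {..<n}" for u
    using that by (auto simp: b_def M_def)
  have b_ne: "fst (b u) \<noteq> fst (b v)" "fst (b u) + fst (b v) \<noteq> M"
    if u: "u \<in> {..<r} \<times> {..<n}" and v: "v \<in> {..<r} \<times> {..<n}" and ne: "fst u \<noteq> fst v" for u v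
  proof -
    have "fst u < r" "fst v < r" using u v by auto
    then show "fst (b u) \<noteq> fst (b v)" "fst (b u) + fst (b v) \<noteq> M"
      unfolding b_def M_def fst_conv using ne by (auto split: if_split)
  qed
  have b_inj: "u = v"
    if u: "u \<in> {..<r} \<times> {..<n}" and v: "v \<in> {..<r} \<times> {..<n}" and eq: "b u = b v" for u v
  proof -
    have bounds: "fst u < r" "fst v < r" "snd u < 2 * m" "snd v < 2 * m"
      using u v n by auto
    have snd_mod: "k mod m = (if k < m then k else k - m)" if "k < 2 * m" for k
      using that by (simp add: le_mod_geq)
    have "(if snd u < m then fst u else M - fst u) = (if snd v < m then fst v else M - fst v)"
      "snd u mod m = snd v mod m"
      using eq by (simp_all add: b_def)
    then have "fst u = fst v \<and> snd u = snd v"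
      unfolding snd_mod[OF bounds(3)] snd_mod[OF bounds(4)] M_def
      using bounds by (auto split: if_splits)
    then show ?thesis by (simp add: prod_eq_iff)
  qed
  have pos: "0 < circle_color M (fst (b u)) (fst (b v))"
    if "u \<in> {..<r} \<times> {..<n}" "v \<in> {..<r} \<times> {..<n}" "fst u \<noteq> fst v" for u v
    using that b_le b_ne by (intro circle_color_pos M) auto
  show ?thesis
  proof (rule that)
    show "c u v = c v u" for u v
      unfolding c_def d_def by (intro blow_up_commute) (simp add: circle_color_commute)
    show "c u v < (r - 1) * n"
      if "u \<in> {..<r} \<times> {..<n}" "v \<in> {..<r} \<times> {..<n}" "fst u \<noteq> fst v" for u v
    proof -
      have "d (fst (b u)) (fst (b v)) < 2 * (r - 1)"
        using circle_color_less[OF odd_pos[OF M], of "fst (b u)" "fst (b v)"] pos[OF that]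
        by (simp add: d_def M_def)
      then have "c u v < 2 * (r - 1) * m"
        unfolding c_def using \<open>0 < m\<close> by (intro blow_up_less)
      then show ?thesis by (simp add: n ac_simps)
    qed
    fix u v w
    assume u: "u \<in> {..<r} \<times> {..<n}" and v: "v \<in> {..<r} \<times> {..<n}"
      and w: "w \<in> {..<r} \<times> {..<n}"
      and uv: "fst u \<noteq> fst v" and uw: "fst u \<noteq> fst w" and eq: "c u v = c u w"
    have "snd (b v) < m" "snd (b w) < m"
      using \<open>0 < m\<close> by (simp_all add: b_def)
    note * = blow_up_eqD[OF eq[unfolded c_def] this]
    have "circle_color M (fst (b u)) (fst (b v)) = circle_color M (fst (b u)) (fst (b w))"
      using *(1) pos[OF u v uv] pos[OF u w uw] by (simp add: d_def)
    then have "fst (b v) = fst (b w)"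
      using circle_color_inj[OF M b_le[OF u] b_le[OF v] b_le[OF w] b_ne(1)[OF u v uv]
          b_ne(1)[OF u w uw]] by simp
    then have "b v = b w" using *(2) by (rule prod_eqI)
    then show "v = w" using b_inj v w by blast
  qed
qed

section \<open>Reduction to a symmetric function on vertex pairs\<close>

text \<open>As many distinct colors as the degree, lying in an interval of just that length, fill
  it; so no spectrum has a gap. Nonnegativity of the deficiencies gives the other
  inequality.\<close>

lemma deficiency_zeroI:
  fixes F :: "'a \<Rightarrow> 'a \<Rightarrow> nat"
  assumes G: "finite_simple_graph V E"
    and sym: "\<And>u v. F u v = F v u"
    and pos: "\<And>u v. 1 \<le> F u v"
    and inj: "\<And>v. v \<in> V \<Longrightarrow> inj_on (F v) {w. {v, w} \<in> E}"
    and range: "\<And>v. v \<in> V \<Longrightarrow> \<exists>a. F v ` {w. {v, w} \<in> E} \<subseteq> {a..<a + card {w. {v, w} \<in> E}}"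
  shows "deficiency V E = 0"
proof -
  \<comment> \<open>Symmetry of \<open>F\<close> makes the chosen value independent of the order of
    the endpoints.\<close>
  define \<alpha> where "\<alpha> e = (SOME k. \<exists>u v. e = {u, v} \<and> k = F u v)" for e
  have \<alpha>: "\<alpha> {u, v} = F u v" for u v
    unfolding \<alpha>_def by (rule some_equality) (auto simp: doubleton_eq_iff sym)
  have edge: "\<exists>w. e = {v, w}" if "e \<in> E" "v \<in> e" for e v
    using that G unfolding finite_simple_graph_def by (metis card_2_iff empty_iff insert_commute insert_iff)
  have V: "v \<in> V" if "e \<in> E" "v \<in> e" for e v
    using that G by (auto simp: finite_simple_graph_def)
  have "proper_edge_coloring E \<alpha>"
    unfolding proper_edge_coloring_def
  proof (intro conjI ballI impI)
    fix e assume "e \<in> E"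
    then have "card e = 2" using G by (simp add: finite_simple_graph_def)
    then show "1 \<le> \<alpha> e" using pos by (auto simp: card_2_iff \<alpha>)
  next
    fix e f assume e: "e \<in> E" and f: "f \<in> E" and "e \<noteq> f \<and> e \<inter> f \<noteq> {}"
    then obtain v where v: "v \<in> e" "v \<in> f" by blast
    obtain x y where xy: "e = {v, x}" "f = {v, y}"
      using edge e f v by blast
    then have "x \<noteq> y" using \<open>e \<noteq> f \<and> _\<close> by blast
    then show "\<alpha> e \<noteq> \<alpha> f"
      using inj[OF V[OF e v(1)]] e f by (auto simp: xy \<alpha> inj_on_def)
  qed
  moreover have "vertex_deficiency E \<alpha> v = 0" if v: "v \<in> V" for v
  proof (cases "spectrum E \<alpha> v = {}")
    case False
    let ?A = "{w. {v, w} \<in> E}"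
    have "{e \<in> E. v \<in> e} = (\<lambda>w. {v, w}) ` ?A"
      using edge by auto
    then have spec: "spectrum E \<alpha> v = F v ` ?A"
      by (simp add: spectrum_def image_image \<alpha>)
    obtain a where a: "F v ` ?A \<subseteq> {a..<a + card ?A}"
      using range[OF v] by blast
    have eq: "spectrum E \<alpha> v = {a..<a + card ?A}"
      unfolding spec using a by (intro card_subset_eq) (simp_all add: card_image inj[OF v])
    have k: "0 < card ?A" using False eq by (cases "card ?A") auto
    have "Max (spectrum E \<alpha> v) = a + card ?A - 1"
      unfolding eq using k by (intro Max_eqI) auto
    moreover have "Min (spectrum E \<alpha> v) = a"
      unfolding eq using k by (intro Min_eqI) auto
    ultimately show ?thesis
      using k False by (simp add: vertex_deficiency_def eq)
  qed (simp add: vertex_deficiency_def)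
  ultimately have "deficiency V E \<le> 0"
    using deficiency_le[OF G, of \<alpha>] by simp
  moreover have "0 \<le> deficiency V E"
    using deficiency_attained[OF G] vertex_deficiency_nonneg[OF finite_edges[OF G]]
    by (metis sum_nonneg)
  ultimately show ?thesis by simp
qed

section \<open>Coordinates on a complete multipartite graph\<close>

text \<open>Coordinates for arithmetic colorings: \<open>p v\<close> is the index of the part of
  \<open>v\<close>, and \<open>i v\<close> its position under a chosen enumeration of that
  part.\<close>

lemma complete_multipartite_labelling:
  assumes "complete_multipartite ns V E"
  obtains p i :: "'a \<Rightarrow> nat" where
    "\<And>v. v \<in> V \<Longrightarrow> p v < length ns"
    "\<And>v. v \<in> V \<Longrightarrow> i v < ns ! p v"
    "\<And>u v. \<lbrakk>u \<in> V; v \<in> V; p u = p v; i u = i v\<rbrakk> \<Longrightarrow> u = v"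
    "\<And>v. v \<in> V \<Longrightarrow> {w. {v, w} \<in> E} = {w \<in> V. p w \<noteq> p v}"
    "\<And>v. v \<in> V \<Longrightarrow> card {w. {v, w} \<in> E} = sum_list ns - ns ! p v"
proof -
  obtain P where V: "V = (\<Union>i<length ns. P i)"
    and disj: "disjoint_family_on P {..<length ns}"
    and P': "\<forall>i<length ns. P i \<noteq> {} \<and> card (P i) = ns ! i \<and> independent_set E (P i)"
    and E': "\<forall>i<length ns. \<forall>j<length ns. i \<noteq> j \<longrightarrow> (\<forall>u\<in>P i. \<forall>v\<in>P j. {u, v} \<in> E)"
    using assms unfolding complete_multipartite_def by (elim conjE exE)
  have G: "finite_simple_graph V E"
    using assms by (simp add: complete_multipartite_def)
  have P: "P i \<noteq> {} \<and> card (P i) = ns ! i \<and> independent_set E (P i)" if "i < length ns" for i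
    using P' that by simp
  have E: "{u, v} \<in> E"
    if "i < length ns" "j < length ns" "i \<noteq> j" "u \<in> P i" "v \<in> P j" for i j u v
    using E' that by simp
  have fin: "finite (P j)" if "j < length ns" for j
    using that G V by (auto simp: finite_simple_graph_def)
  have "\<exists>g. bij_betw g (P j) {..<ns ! j}" if "j < length ns" for j
    using ex_bij_betw_finite_nat[OF fin[OF that]] P[OF that] by (simp add: atLeast0LessThan)
  then obtain g where g: "\<And>j. j < length ns \<Longrightarrow> bij_betw (g j) (P j) {..<ns ! j}"
    by metis
  have "\<forall>v\<in>V. \<exists>j<length ns. v \<in> P j" using V by blast
  then obtain p where p: "\<And>v. v \<in> V \<Longrightarrow> p v < length ns \<and> v \<in> P (p v)"
    by metis
  have p_eq: "p v = j" if "j < length ns" "v \<in> P j" for v j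
  proof (rule ccontr)
    assume "p v \<noteq> j"
    moreover have v: "v \<in> V" using that unfolding V by blast
    ultimately have "P (p v) \<inter> P j = {}"
      using disj that(1) p[OF v] by (simp add: disjoint_family_on_def)
    then show False using p[OF v] that(2) by blast
  qed
  have nbrs: "{w. {v, w} \<in> E} = V - P (p v)" if v: "v \<in> V" for v
  proof (intro set_eqI iffI)
    fix w assume "w \<in> {w. {v, w} \<in> E}"
    then have vw: "{v, w} \<in> E" by simp
    then have "{v, w} \<subseteq> V" using G unfolding finite_simple_graph_def by blast
    moreover have "independent_set E (P (p v))" "v \<in> P (p v)" using P p[OF v] by blast+
    ultimately show "w \<in> V - P (p v)" using vw unfolding independent_set_def by blast
  next
    fix w assume "w \<in> V - P (p v)"
    then show "w \<in> {w. {v, w} \<in> E}" using E[of "p v" "p w" v w] p[of w] p[OF v]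
      by (cases "p v = p w") auto
  qed
  have "card V = (\<Sum>j<length ns. card (P j))"
    unfolding V using disj fin
    by (intro card_UN_disjoint) (simp_all add: disjoint_family_on_def)
  also have "\<dots> = sum_list ns"
    using P by (simp add: sum_list_sum_nth atLeast0LessThan)
  finally have card_V: "card V = sum_list ns" .
  show ?thesis
  proof (rule that[of p "\<lambda>v. g (p v) v"])
    show "p v < length ns" if "v \<in> V" for v using p[OF that] by simp
    show "g (p v) v < ns ! p v" if "v \<in> V" for v
      using p[OF that] g[of "p v"] by (auto simp: bij_betw_def)
    show "u = v" if "u \<in> V" "v \<in> V" "p u = p v" "g (p u) u = g (p v) v" for u v
    proof (rule inj_onD)
      show "inj_on (g (p u)) (P (p u))"
        using g p[OF that(1)] by (simp add: bij_betw_def)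
    qed (use that p[OF that(1)] p[OF that(2)] in simp_all)
    show "{w. {v, w} \<in> E} = {w \<in> V. p w \<noteq> p v}" if "v \<in> V" for v
    proof -
      have "w \<in> P (p v) \<longleftrightarrow> p w = p v" if "w \<in> V" for w
        using p_eq[of "p v" w] p[OF that] p[OF \<open>v \<in> V\<close>] by auto
      then show ?thesis unfolding nbrs[OF that] by blast
    qed
    show "card {w. {v, w} \<in> E} = sum_list ns - ns ! p v" if "v \<in> V" for v
    proof -
      have "P (p v) \<subseteq> V" using p[OF that] V by blast
      then show ?thesis
        unfolding nbrs[OF that] using fin[of "p v"] P[of "p v"] p[OF that]
        by (simp add: card_Diff_subset card_V)
    qed
  qed
qed

section \<open>Assembling the interval coloring\<close>

theorem theorem8:
  fixes n r t :: nat and V :: "'a set" and E :: "'a set set"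
  assumes "n \<ge> 1" and "r \<ge> 1" and "t \<ge> 1"
    and "even (n * r)"
    and "complete_multipartite (replicate r n @ [t * r * n]) V E"
  shows "deficiency V E = 0"
proof -
  define N where "N = r * n"
  have N: "0 < N" using assms(1,2) by (simp add: N_def)
  have G: "finite_simple_graph V E"
    using assms(5) by (simp add: complete_multipartite_def)
  obtain p i where p: "\<And>v. v \<in> V \<Longrightarrow> p v < length (replicate r n @ [t * r * n])"
    and i: "\<And>v. v \<in> V \<Longrightarrow> i v < (replicate r n @ [t * r * n]) ! p v"
    and pi_inj: "\<And>u v. \<lbrakk>u \<in> V; v \<in> V; p u = p v; i u = i v\<rbrakk> \<Longrightarrow> u = v"
    and nbrs: "\<And>v. v \<in> V \<Longrightarrow> {w. {v, w} \<in> E} = {w \<in> V. p w \<noteq> p v}"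
    and card_nbrs: "\<And>v. v \<in> V \<Longrightarrow> card {w. {v, w} \<in> E}
      = sum_list (replicate r n @ [t * r * n]) - (replicate r n @ [t * r * n]) ! p v"
    using complete_multipartite_labelling[OF assms(5)] by blast
  obtain c where c_sym: "\<And>u v. c u v = c v u"
    and c_less: "\<And>u v. \<lbrakk>u \<in> {..<r} \<times> {..<n}; v \<in> {..<r} \<times> {..<n}; fst u \<noteq> fst v\<rbrakk>
      \<Longrightarrow> c u v < (r - 1) * n"
    and c_inj: "\<And>u v w. \<lbrakk>u \<in> {..<r} \<times> {..<n}; v \<in> {..<r} \<times> {..<n}; w \<in> {..<r} \<times> {..<n};
       fst u \<noteq> fst v; fst u \<noteq> fst w; c u v = c u w\<rbrakk> \<Longrightarrow> v = w"
    using balanced_multipartite_one_factorization[of n r] assms(1,2,4) by auto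
  have small: "p v < r \<Longrightarrow> i v < n" and large: "\<not> p v < r \<Longrightarrow> p v = r \<and> i v < t * N"
    if "v \<in> V" for v
    using p[OF that] i[OF that] by (auto simp: nth_append N_def mult.assoc split: if_splits)
  \<comment> \<open>On the small parts, \<open>a\<close> numbers all vertices consecutively below
    \<open>N\<close>, giving the rows of the Latin squares.\<close>
  define a where "a v = p v * n + i v" for v
  define l where "l v = (p v, i v)" for v
  \<comment> \<open>For \<open>u\<close> small and \<open>v\<close> large: \<open>i v div N\<close>
    is the block of \<open>v\<close>, the residue is the Latin square entry, and 1 is added because
    colors start at 1.\<close>
  define B where "B u v = i v div N * N + (a u + i v) mod N + 1" for u v
  \<comment> \<open>The final 1 is a positive default for two vertices of the large part, which are
    not adjacent.\<close>
  define F where "F u v =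
    (if p u < r then if p v < r then t * N + c (l u) (l v) + 1 else B u v
     else if p v < r then B v u else 1)" for u v
  have l: "l v \<in> {..<r} \<times> {..<n}" "fst (l v) = p v" if "v \<in> V" "p v < r" for v
    using that small by (auto simp: l_def)
  have a_less: "a v < N" if "v \<in> V" "p v < r" for v
  proof -
    have "a v < Suc (p v) * n" using small[OF that] by (simp add: a_def)
    also have "\<dots> \<le> N" unfolding N_def using that by (intro mult_le_mono1) simp
    finally show ?thesis .
  qed
  have a_inj: "u = v" if "u \<in> V" "v \<in> V" "p u < r" "p v < r" "a u = a v" for u v
  proof -
    have "a u div n = a v div n" "a u mod n = a v mod n" using that by simp_all
    then show ?thesis
      using that small[of u] small[of v] assms(1) by (intro pi_inj) (simp_all add: a_def)
  qed
  have B_le: "B u v \<le> t * N" if "i v < t * N" for u v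
  proof -
    have "i v div N < t" using that N by (simp add: less_mult_imp_div_less)
    then have "Suc (i v div N) * N \<le> t * N" by (intro mult_le_mono1) simp
    moreover have "(a u + i v) mod N < N" using N by simp
    ultimately show ?thesis by (simp add: B_def)
  qed
  have B_inj_large: "i v = i w" if "B u v = B u w" for u v w
  proof -
    have "(B u v - 1) div N = (B u w - 1) div N" "(B u v - 1) mod N = (B u w - 1) mod N"
      using that by simp_all
    then have div: "i v div N = i w div N" and "(a u + i v) mod N = (a u + i w) mod N"
      using N by (simp_all add: B_def)
    \<comment> \<open>Cancellation applies to summands below \<open>N\<close>, so the positions are
      first reduced.\<close>
    then have "(a u + i v mod N) mod N = (a u + i w mod N) mod N"
      by (simp add: mod_simps)
    then have "i v mod N = i w mod N"
      by (rule mod_add_left_cancel_nat) (simp_all add: N)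
    with div show ?thesis by (metis div_mult_mod_eq)
  qed
  have inj: "x = y"
    if v: "v \<in> V" and x: "x \<in> V" "p x \<noteq> p v" and y: "y \<in> V" "p y \<noteq> p v" and eq: "F v x = F v y"
    for v x y
  proof (cases "p v < r")
    case True
    consider "p x < r" "p y < r" | "p x < r" "\<not> p y < r" | "\<not> p x < r" "p y < r"
      | "\<not> p x < r" "\<not> p y < r" by blast
    then show ?thesis
    proof cases
      case 1
      then have "l x = l y"
        using eq True l x y v by (intro c_inj[of "l v"]) (simp_all add: F_def)
      then show ?thesis using pi_inj x y by (simp add: l_def)
    next
      case 2
      \<comment> \<open>Colors between small parts exceed \<open>t * N\<close>, while colors towards
        the large part do not.\<close>
      then show ?thesis using eq True B_le[of y v] large[OF y(1)] by (simp add: F_def)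
    next
      case 3
      then show ?thesis using eq True B_le[of x v] large[OF x(1)] by (simp add: F_def)
    next
      case 4
      then have "i x = i y" using eq True by (intro B_inj_large) (simp add: F_def)
      then show ?thesis using pi_inj[OF x(1) y(1)] large[OF x(1)] large[OF y(1)] 4 by simp
    qed
  next
    case False
    \<comment> \<open>A large \<open>v\<close> has only small neighbours, and all its colors lie in
      one block, so only the residues have to be compared.\<close>
    then have xy: "p x < r" "p y < r"
      using large[OF v] large[OF x(1)] large[OF y(1)] x(2) y(2) by auto
    then have "(a x + i v) mod N = (a y + i v) mod N"
      using eq False by (simp add: F_def B_def)
    then have "a x = a y"
      using a_less[OF x(1) xy(1)] a_less[OF y(1) xy(2)]
        mod_add_left_cancel_nat[of "i v" "a x" N "a y"] by (simp add: add.commute)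
    then show ?thesis using a_inj x y xy by blast
  qed
  have range: "\<exists>b. F v ` {w \<in> V. p w \<noteq> p v} \<subseteq> {b..<b + card {w. {v, w} \<in> E}}" if v: "v \<in> V" for v
  proof (cases "p v < r")
    case True
    \<comment> \<open>The degree is the total \<open>N + t * N\<close> minus the own part
      \<open>n\<close>; the spectrum starts at 1.\<close>
    have "card {w. {v, w} \<in> E} = t * N + (r - 1) * n"
      using True v assms(2)
      by (simp add: card_nbrs nth_append sum_list_replicate N_def diff_mult_distrib)
    moreover have "F v w \<in> {1..<1 + (t * N + (r - 1) * n)}" if w: "w \<in> V" "p w \<noteq> p v" for w
    proof (cases "p w < r")
      case pw: True
      then show ?thesis
        using c_less[OF l(1)[OF v True] l(1)[OF w(1) pw]] w True by (simp add: F_def l_def)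
    next
      case False
      then show ?thesis
        using B_le[of w v] large[OF w(1)] True by (simp add: F_def) (simp add: B_def)
    qed
    ultimately show ?thesis by (intro exI[of _ 1]) auto
  next
    case False
    then have "card {w. {v, w} \<in> E} = N"
      using v large[OF v] by (simp add: card_nbrs nth_append sum_list_replicate N_def)
    \<comment> \<open>These are the \<open>N\<close> colors of the block of
      \<open>v\<close>.\<close>
    moreover have "F v w \<in> {i v div N * N + 1..<i v div N * N + 1 + N}"
      if w: "w \<in> V" "p w \<noteq> p v" for w
    proof -
      have "p w < r" using False large[OF v] large[OF w(1)] w(2) by auto
      then show ?thesis using False N by (simp add: F_def B_def)
    qed
    ultimately show ?thesis by (intro exI[of _ "i v div N * N + 1"]) auto
  qed
  show ?thesis
  proof (rule deficiency_zeroI[OF G, of F])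
    show "F u v = F v u" for u v by (simp add: F_def c_sym)
    show "1 \<le> F u v" for u v by (simp add: F_def B_def)
    show "inj_on (F v) {w. {v, w} \<in> E}" if "v \<in> V" for v
      unfolding nbrs[OF that] using inj[OF that] by (auto intro: inj_onI)
    show "\<exists>b. F v ` {w. {v, w} \<in> E} \<subseteq> {b..<b + card {w. {v, w} \<in> E}}" if "v \<in> V" for v
      using range[OF that] nbrs[OF that] by simp
  qed
qed

end
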